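(* Let $\sigma$ be a permutation of length $n$, let $t\ge 0$ be an integer, and put $\sigma_t=\mathsf{Pop}^t(\sigma)$. Suppose that the element $\sigma_t(i)$ is in the interior of an increasing run of $\sigma_t$. Then $\sigma_t(i)$ is either a left-to-right maximum of $\sigma_t$, or there are at least $\left\lceil \frac{t+1}{2}\right\rceil$ elements smaller than $\sigma_t(i)$ to its left in $\sigma_t$. Similarly, $\sigma_t(i)$ is either a right-to-left minimum of $\sigma_t$, or there are at least $\left\lceil \frac{t+1}{2}\right\rceil$ elements larger than $\sigma_t(i)$ to its right in $\sigma_t$.
   Context: A permutation of length $n$ is an ordered list (one-line notation) $\sigma(1)\sigma(2)\cdots\sigma(n)$ of the elements of $\{1,\dots,n\}$, each appearing exactly once. The map $\mathsf{Pop}$ from permutations of length $n$ to permutations of length $n$ reverses, in place and simultaneously, every maximal block of consecutive entries that is decreasing; for example, $\mathsf{Pop}(471836952)=417386259$ (the blocks $71$, $83$, $952$ are reversed). $\mathsf{Pop}^t$ denotes the $t$-fold iterate, with $\mathsf{Pop}^0$ the identity map. An increasing run of a permutation is a maximal set of at least two entries occupying consecutive positions whose values increase from left to right. An element is in the interior of an increasing run if it belongs to that run but is neither the first nor the last element of that run. An entry is a left-to-right maximum if it is larger than every entry to its left, and a right-to-left minimum if it is smaller than every entry to its right. *)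

theory Defs
  imports Complex_Main "HOL-Combinatorics.Multiset_Permutations"
begin

text \<open>
  A permutation of length \<open>n\<close> in one-line notation is a list in \<open>permutations_of_set {1..n}\<close>.
  Entries are numbered from 1 to \<open>n\<close>, but positions are list indices and hence start at 0.
\<close>

fun decreasing_blocks :: "nat list \<Rightarrow> nat list list" where
  "decreasing_blocks [] = []"
| "decreasing_blocks [x] = [[x]]"
| "decreasing_blocks (x # y # ys) =
     (case decreasing_blocks (y # ys) of
        [] \<Rightarrow> [[x]]
      | b # bs \<Rightarrow> if x > y then (x # b) # bs else [x] # b # bs)"

text \<open>
  In the last equation \<open>b\<close> starts with \<open>y\<close>, and the case \<open>[]\<close> does not arise. The facts
  \<open>concat_decreasing_blocks\<close>, \<open>decreasing_blocks_decreasing\<close> and \<open>decreasing_blocks_maximal\<close>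
  below characterise the result: the list is cut into nonempty decreasing blocks, none of which
  can be extended into its neighbour.
\<close>

definition Pop :: "nat list \<Rightarrow> nat list" where
  "Pop xs = concat (map rev (decreasing_blocks xs))"

definition increasing_between :: "nat list \<Rightarrow> nat \<Rightarrow> nat \<Rightarrow> bool" where
  "increasing_between xs a b \<longleftrightarrow>
     a < b \<and> b < length xs \<and> (\<forall>j k. a \<le> j \<and> j < k \<and> k \<le> b \<longrightarrow> xs ! j < xs ! k)"

text \<open>
  A run is given by the positions \<open>a < b\<close> of its first and last entries; \<open>a < b\<close> says that it has
  at least two entries.
\<close>

definition increasing_run :: "nat list \<Rightarrow> nat \<Rightarrow> nat \<Rightarrow> bool" where
  "increasing_run xs a b \<longleftrightarrow>
     increasing_between xs a b \<and>
     (\<forall>a' b'. a' \<le> a \<and> b \<le> b' \<and> increasing_between xs a' b' \<longrightarrow> a' = a \<and> b' = b)"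

definition in_run_interior :: "nat list \<Rightarrow> nat \<Rightarrow> bool" where
  "in_run_interior xs i \<longleftrightarrow> (\<exists>a b. increasing_run xs a b \<and> a < i \<and> i < b)"

definition left_to_right_max :: "nat list \<Rightarrow> nat \<Rightarrow> bool" where
  "left_to_right_max xs i \<longleftrightarrow> i < length xs \<and> (\<forall>j<i. xs ! j < xs ! i)"

definition right_to_left_min :: "nat list \<Rightarrow> nat \<Rightarrow> bool" where
  "right_to_left_min xs i \<longleftrightarrow> i < length xs \<and> (\<forall>j. i < j \<and> j < length xs \<longrightarrow> xs ! i < xs ! j)"

definition smaller_to_left :: "nat list \<Rightarrow> nat \<Rightarrow> nat set" where
  "smaller_to_left xs i = {x \<in> set (take i xs). x < xs ! i}"

definition larger_to_right :: "nat list \<Rightarrow> nat \<Rightarrow> nat set" where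
  "larger_to_right xs i = {x \<in> set (drop (Suc i) xs). x > xs ! i}"

lemma decreasing_blocks_Cons:
  "\<exists>b bs. decreasing_blocks (x # xs) = (x # b) # bs"
proof (cases xs)
  case (Cons y ys)
  then show ?thesis by (cases "decreasing_blocks (y # ys)") auto
qed simp

lemma concat_decreasing_blocks: "concat (decreasing_blocks xs) = xs"
proof (induction xs rule: decreasing_blocks.induct)
  case (3 x y ys)
  obtain b bs where "decreasing_blocks (y # ys) = (y # b) # bs"
    using decreasing_blocks_Cons by blast
  then show ?case using "3.IH" by simp
qed simp_all

lemma decreasing_blocks_decreasing:
  "\<forall>b \<in> set (decreasing_blocks xs). b \<noteq> [] \<and> sorted_wrt (>) b"
proof (induction xs rule: decreasing_blocks.induct)
  case (3 x y ys)
  obtain b bs where *: "decreasing_blocks (y # ys) = (y # b) # bs"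
    using decreasing_blocks_Cons by blast
  show ?case
  proof (cases "x > y")
    case True
    then have "sorted_wrt (>) (x # y # b)"
      using "3.IH" * by (auto intro: less_trans)
    then show ?thesis using "3.IH" * True by simp
  next
    case False
    then show ?thesis using "3.IH" * by simp
  qed
qed simp_all

lemma decreasing_blocks_maximal:
  "successively (\<lambda>b c. last b \<le> hd c) (decreasing_blocks xs)"
proof (induction xs rule: decreasing_blocks.induct)
  case (3 x y ys)
  obtain b bs where *: "decreasing_blocks (y # ys) = (y # b) # bs"
    using decreasing_blocks_Cons by blast
  show ?case using "3.IH" * by (cases bs) simp_all
qed simp_all

lemma "Pop [4, 7, 1, 8, 3, 6, 9, 5, 2] = [4, 1, 7, 3, 8, 6, 2, 5, 9]"
  by (simp add: Pop_def)

end

theory Submission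
  imports Defs
begin

text \<open>
  Fix a value \<open>v\<close> and call an entry small if it is at most \<open>v\<close>, and large otherwise. Suppose that a
  decreasing block of \<open>Pop\<^sup>t \<sigma>\<close> starts with a small entry at position \<open>a\<close> and that some large entry
  precedes it. Then \<open>t < 2r\<close>, where \<open>r\<close> counts the small entries before \<open>a\<close>. To see this by
  induction on \<open>t\<close>, note that the entry at \<open>a - 1\<close> is also small. Let \<open>B\<close> be the block of
  \<open>Pop\<^bsup>t-1\<^esup> \<sigma>\<close> around position \<open>a - 1\<close>. If \<open>B\<close> starts with a small entry, the induction hypothesis
  for \<open>t - 1\<close> applies to \<open>B\<close>. Otherwise \<open>B\<close> contains a large entry and at least two small ones.
  The middle entry of three consecutive decreasing ones in an image of \<open>Pop\<close> was a block of its own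
  before; hence \<open>B\<close> has length three, and the induction hypothesis for \<open>t - 2\<close> applies to its middle
  entry. An interior entry of an increasing run is a singleton block, and the second half of the
  theorem follows by reversing and complementing.
\<close>

section \<open>Decreasing blocks as intervals of positions\<close>

text \<open>Both ends are inclusive. Maximality is only a comparison with the two neighbours, and
  equal neighbours lie in different blocks, as in \<open>decreasing_blocks\<close>.\<close>

definition block_at :: "nat list \<Rightarrow> nat \<Rightarrow> nat \<Rightarrow> bool" where
  "block_at xs a b \<longleftrightarrow> a \<le> b \<and> b < length xs \<and>
     (\<forall>i. a \<le> i \<and> i < b \<longrightarrow> xs ! Suc i < xs ! i) \<and>
     (0 < a \<longrightarrow> xs ! (a - 1) \<le> xs ! a) \<and>
     (Suc b < length xs \<longrightarrow> xs ! b \<le> xs ! Suc b)"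

lemma block_at_exists:
  assumes "p < length xs"
  obtains a b where "block_at xs a b" "a \<le> p" "p \<le> b"
proof -
  \<comment> \<open>\<open>L\<close> and \<open>R\<close> describe the positions joined to
    \<open>p\<close> by descents only; the extreme ones are the ends of the block.\<close>
  define L where "L a \<longleftrightarrow> a \<le> p \<and> (\<forall>i. a \<le> i \<and> i < p \<longrightarrow> xs ! Suc i < xs ! i)" for a
  define R where "R b \<longleftrightarrow> p \<le> b \<and> b < length xs \<and> (\<forall>i. p \<le> i \<and> i < b \<longrightarrow> xs ! Suc i < xs ! i)" for b
  define a where "a = (LEAST a. L a)"
  define b where "b = (GREATEST b. R b)"
  have R_le: "\<forall>c. R c \<longrightarrow> c \<le> length xs"
    by (simp add: R_def)
  have a: "L a"
    unfolding a_def by (rule LeastI[of L p]) (simp add: L_def)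
  have b: "R b"
    unfolding b_def by (rule GreatestI_nat[of R p "length xs"]) (use assms in \<open>auto simp: R_def\<close>)
  have "\<not> xs ! a < xs ! (a - 1)" if "0 < a"
  proof
    assume *: "xs ! a < xs ! (a - 1)"
    have "L (a - 1)"
      unfolding L_def
    proof (intro conjI allI impI)
      fix i assume "a - 1 \<le> i \<and> i < p"
      then show "xs ! Suc i < xs ! i"
        using a * that by (cases "i = a - 1") (auto simp: L_def)
    qed (use a in \<open>auto simp: L_def\<close>)
    then show False
      using Least_le[of L "a - 1"] that by (simp add: a_def)
  qed
  moreover have "\<not> xs ! Suc b < xs ! b" if "Suc b < length xs"
  proof
    assume *: "xs ! Suc b < xs ! b"
    have "R (Suc b)"
      unfolding R_def
    proof (intro conjI allI impI)
      fix i assume "p \<le> i \<and> i < Suc b"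
      then show "xs ! Suc i < xs ! i"
        using b * by (cases "i = b") (auto simp: R_def)
    qed (use b that in \<open>auto simp: R_def\<close>)
    then show False
      using Greatest_le_nat[of R "Suc b" "length xs", folded b_def] R_le by simp
  qed
  moreover have "xs ! Suc i < xs ! i" if "a \<le> i" "i < b" for i
    using a b that by (cases "i < p") (auto simp: L_def R_def)
  ultimately have "block_at xs a b"
    using a b by (auto simp: block_at_def L_def R_def not_less)
  with a b show thesis
    by (intro that) (auto simp: L_def R_def)
qed

section \<open>The action of \<open>Pop\<close> on a single block\<close>

text \<open>Whether two neighbours share a block depends on these two alone, so a non-descent splits
  the computation.\<close>

lemma decreasing_blocks_append:
  assumes "ys \<noteq> []" "zs \<noteq> []" "last ys \<le> hd zs"
  shows "decreasing_blocks (ys @ zs) = decreasing_blocks ys @ decreasing_blocks zs"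
  using assms
proof (induction ys rule: decreasing_blocks.induct)
  case (2 x)
  obtain z zs' where zs: "zs = z # zs'"
    using 2 by (cases zs) auto
  obtain b bs where "decreasing_blocks zs = (z # b) # bs"
    using decreasing_blocks_Cons zs by blast
  then show ?case using 2 zs by simp
next
  case (3 x y ys)
  obtain b bs where "decreasing_blocks (y # ys) = (y # b) # bs"
    using decreasing_blocks_Cons by blast
  then show ?case using 3 by simp
qed simp

lemma decreasing_blocks_of_decreasing:
  assumes "xs \<noteq> []" "sorted_wrt (>) xs"
  shows "decreasing_blocks xs = [xs]"
  using assms by (induction xs rule: decreasing_blocks.induct) auto

lemma Pop_append:
  assumes "ys \<noteq> [] \<Longrightarrow> zs \<noteq> [] \<Longrightarrow> last ys \<le> hd zs"
  shows "Pop (ys @ zs) = Pop ys @ Pop zs"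
  using assms decreasing_blocks_append[of ys zs]
  by (cases "ys = []"; cases "zs = []") (auto simp: Pop_def)

lemma mset_Pop [simp]: "mset (Pop xs) = mset xs"
proof -
  have "mset (concat (map rev bs)) = mset (concat bs)" for bs :: "nat list list"
    by (induction bs) auto
  then show ?thesis
    by (simp add: Pop_def concat_decreasing_blocks)
qed

lemma set_Pop [simp]: "set (Pop xs) = set xs"
  by (rule mset_eq_setD) simp

lemma length_Pop [simp]: "length (Pop xs) = length xs"
  by (rule mset_eq_length) simp

text \<open>The non-descents at both ends of the block allow two cuts, and the piece between them is
  one block.\<close>

lemma Pop_block_decomp:
  assumes "block_at xs a b"
  shows "Pop xs = Pop (take a xs) @ rev (take (Suc b - a) (drop a xs)) @ Pop (drop (Suc b) xs)"
proof -
  note B = assms[unfolded block_at_def]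
  define ds where "ds = take (Suc b - a) (drop a xs)"
  have len: "length ds = Suc b - a"
    using B by (auto simp: ds_def)
  have nth: "ds ! i = xs ! (a + i)" if "i < Suc b - a" for i
    using that B by (simp add: ds_def)
  have ne: "ds \<noteq> []"
    using len B by auto
  have "sorted_wrt (>) ds"
    using B by (subst sorted_wrt_iff_nth_Suc_transp) (auto simp: transp_on_def len nth)
  then have Pds: "Pop ds = rev ds"
    using ne by (simp add: Pop_def decreasing_blocks_of_decreasing)
  have "drop a xs = ds @ drop (Suc b) xs"
    using B append_take_drop_id[of "Suc b - a" "drop a xs"] by (simp add: ds_def)
  then have xs: "xs = take a xs @ ds @ drop (Suc b) xs"
    by (metis append_take_drop_id)
  have last: "last ds = xs ! b" and hd: "hd ds = xs ! a"
    using ne B by (auto simp: last_conv_nth hd_conv_nth nth len)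
  have "Pop (ds @ drop (Suc b) xs) = Pop ds @ Pop (drop (Suc b) xs)"
    by (rule Pop_append) (use B in \<open>auto simp: last hd_drop_conv_nth\<close>)
  moreover have "Pop (take a xs @ ds @ drop (Suc b) xs)
      = Pop (take a xs) @ Pop (ds @ drop (Suc b) xs)"
    by (rule Pop_append) (use B ne in \<open>auto simp: hd last_conv_nth min_def\<close>)
  ultimately show ?thesis
    using xs Pds ds_def by metis
qed

lemma nth_Pop_block:
  assumes "block_at xs a b" "a \<le> i" "i \<le> b"
  shows "Pop xs ! i = xs ! (a + b - i)"
proof -
  have "a \<le> b" "b < length xs"
    using assms(1) by (auto simp: block_at_def)
  then have "length (take a xs) = a" "length (take (Suc b - a) (drop a xs)) = Suc b - a"
    by auto
  moreover have "i - a < Suc b - a" "\<not> i < a"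
    using assms(2,3) by auto
  moreover have "a + (Suc b - a - Suc (i - a)) = a + b - i"
    using assms(2,3) by auto
  ultimately show ?thesis
    using \<open>b < length xs\<close> by (subst Pop_block_decomp[OF assms(1)]) (simp add: nth_append rev_nth)
qed

text \<open>No entry crosses the start of a block, so counts over the prefix survive one application
  of \<open>Pop\<close>.\<close>

lemma set_take_Pop_block:
  assumes "block_at xs a b"
  shows "set (take a (Pop xs)) = set (take a xs)"
  using assms by (subst Pop_block_decomp[OF assms(1)]) (auto simp: block_at_def)

lemma Pop_block_increasing:
  assumes "block_at xs a b" "a \<le> i" "i < b"
  shows "Pop xs ! i < Pop xs ! Suc i"
proof -
  have "xs ! Suc (a + b - Suc i) < xs ! (a + b - Suc i)"
  proof -
    have "a \<le> a + b - Suc i" "a + b - Suc i < b"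
      using assms(2,3) by auto
    then show ?thesis
      using assms(1) unfolding block_at_def by blast
  qed
  moreover have "Suc (a + b - Suc i) = a + b - i"
    using assms by auto
  ultimately show ?thesis
    using assms by (simp add: nth_Pop_block)
qed

section \<open>Consecutive descents in images of \<open>Pop\<close>\<close>

text \<open>A reversed block is increasing, so every descent of the image straddles a block
  boundary; two successive descents isolate the entry between them.\<close>

lemma block_at_singleton_of_Pop:
  assumes "Suc (Suc i) < length xs"
    and "Pop xs ! Suc i < Pop xs ! i" "Pop xs ! Suc (Suc i) < Pop xs ! Suc i"
  shows "block_at xs (Suc i) (Suc i)"
proof -
  obtain a b where ab: "block_at xs a b" "a \<le> Suc i" "Suc i \<le> b"
    using block_at_exists[of "Suc i" xs] assms by auto
  have "\<not> a \<le> i"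
    using Pop_block_increasing[OF ab(1), of i] assms(2) ab(3) by linarith
  moreover have "\<not> Suc i < b"
    using Pop_block_increasing[OF ab(1), of "Suc i"] assms(3) ab(2) by linarith
  ultimately have "a = Suc i" "b = Suc i"
    using ab by linarith+
  with ab show ?thesis
    by simp
qed

text \<open>Four decreasing entries would make the two middle positions adjacent singleton blocks.
  \<open>Pop\<close> fixes both, yet adjacent singletons form a non-descent.\<close>

lemma Pop_decreasing_length_le_3:
  assumes "i + 3 < length xs"
    and "Pop xs ! (i + 1) < Pop xs ! i" "Pop xs ! (i + 2) < Pop xs ! (i + 1)"
  shows "Pop xs ! (i + 2) \<le> Pop xs ! (i + 3)"
proof (rule ccontr)
  assume "\<not> ?thesis"
  then have *: "block_at xs (i + 1) (i + 1)" "block_at xs (i + 2) (i + 2)"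
    using assms block_at_singleton_of_Pop[of i xs] block_at_singleton_of_Pop[of "i + 1" xs]
    by (auto simp: eval_nat_numeral)
  then have "xs ! (i + 1) \<le> xs ! (i + 2)"
    by (auto simp: block_at_def)
  then show False
    using nth_Pop_block[OF *(1), of "i + 1"] nth_Pop_block[OF *(2), of "i + 2"] assms by simp
qed

section \<open>Counting small entries before a block\<close>

lemma mset_Pop_funpow [simp]: "mset ((Pop ^^ t) xs) = mset xs"
  by (induction t) auto

text \<open>The threshold \<open>v\<close> is separate from the first entry of the block because the
  induction passes to other blocks while \<open>v\<close> stays fixed.\<close>

lemma small_block_start_bound:
  assumes "distinct xs" "block_at ((Pop ^^ t) xs) a b" "(Pop ^^ t) xs ! a \<le> v"
    and "\<exists>x \<in> set (take a ((Pop ^^ t) xs)). v < x"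
  shows "t < 2 * card {x \<in> set (take a ((Pop ^^ t) xs)). x \<le> v}"
  using assms(2-)
\<comment> \<open>Strong induction, since the argument goes back one or two iterations.\<close>
proof (induction t arbitrary: a b rule: less_induct)
  case (less t)
  define r where "r s a = card {x \<in> set (take a ((Pop ^^ s) xs)). x \<le> v}" for s a
  have r_mono: "r s a \<le> r s a'" if "a \<le> a'" for s a a'
    unfolding r_def using set_take_subset_set_take[OF that, of "(Pop ^^ s) xs"]
    by (intro card_mono) auto
  define w where "w = (Pop ^^ t) xs"
  have dist: "distinct w"
    using assms(1) mset_eq_imp_distinct_iff[of w xs] by (simp add: w_def)
  note W = less.prems[folded w_def]
  have a: "0 < a" "a < length w"
    using W by (auto simp: block_at_def intro: Suc_leI gr0I)
  obtain p where p: "a = Suc p"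
    using a by (cases a) auto
  have small_p: "w ! p \<le> v"
    using W p by (auto simp: block_at_def)
  have take_a: "take a w = take p w @ [w ! p]"
    using a p by (simp add: take_Suc_conv_app_nth)
  have "w ! p \<notin> set (take p w)"
    using distinct_take[OF dist, of a] by (simp add: take_a)
  moreover have "{x \<in> set (take a w). x \<le> v} = insert (w ! p) {x \<in> set (take p w). x \<le> v}"
    using small_p by (auto simp: take_a)
  ultimately have r_a: "r t a = Suc (r t p)"
    by (simp add: r_def w_def[symmetric])
  have large_p: "\<exists>x \<in> set (take p w). v < x"
    using W(3) small_p by (auto simp: take_a)
  show ?case
  proof (cases "t < 2")
    case True
    then show ?thesis
      using r_a by (simp add: r_def)
  next
    case False
    then obtain s where s: "t = Suc (Suc s)"
      by (metis add_2_eq_Suc le_Suc_ex not_less)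
    define u where "u = (Pop ^^ Suc s) xs"
    have w: "w = Pop u"
      by (simp add: w_def u_def s)
    obtain c d where B: "block_at u c d" "c \<le> p" "p \<le> d"
      using block_at_exists[of p u] a p w by auto
    have prefix: "set (take c w) = set (take c u)"
      unfolding w by (rule set_take_Pop_block[OF B(1)])
    then have "r (Suc s) c = r t c"
      by (simp add: r_def w_def u_def)
    \<comment> \<open>The small entry at \<open>p\<close> lies before \<open>a\<close> but not
      before \<open>c\<close>. This gain of one raises the bound by two, enough to pay for two
      iterations.\<close>
    then have r_c: "r (Suc s) c < r t a"
      using r_mono[OF B(2), of t] r_a by simp
    have w_nth: "w ! i = u ! (c + d - i)" if "c \<le> i" "i \<le> d" for i
      unfolding w using nth_Pop_block[OF B(1)] that by simp
    have u_mono: "u ! j \<le> u ! i" if "c \<le> i" "i \<le> j" "j \<le> d" for i j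
      using that(2,3)
    proof (induction j rule: dec_induct)
      case (step n)
      then have "u ! Suc n < u ! n"
        using B(1) that(1) by (auto simp: block_at_def)
      then show ?case using step by simp
    qed simp
    have d: "d < length u"
      using B(1) by (simp add: block_at_def)
    show ?thesis
    proof (cases "u ! c \<le> v")
      case True
      \<comment> \<open>The block starts small, hence is entirely small, so the large entry must lie
        before \<open>c\<close>.\<close>
      have "w ! i \<le> v" if "c \<le> i" "i < p" for i
      proof -
        have "u ! (c + d - i) \<le> u ! c"
          by (rule u_mono) (use that B in auto)
        then show ?thesis
          using w_nth[of i] B True that by simp
      qed
      moreover obtain i where i: "i < p" "v < w ! i"
        using large_p a p by (auto simp: in_set_conv_nth)
      ultimately have "i < c"
        by (meson leD leI)
      then have "w ! i \<in> set (take c w)"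
        using a p w B(2) by (auto simp: in_set_conv_nth intro!: exI[of _ i])
      then have "\<exists>x \<in> set (take c u). v < x"
        using i prefix by auto
      then have "Suc s < 2 * r (Suc s) c"
        using less.IH[of "Suc s" c d] B(1) True by (simp add: s u_def r_def)
      then show ?thesis
        using r_c by (simp add: s r_def)
    next
      case False
      \<comment> \<open>Reversal puts the large entry \<open>u ! c\<close> at position
        \<open>d\<close>, whereas \<open>w ! p\<close> and \<open>w ! a\<close> are small.\<close>
      then have "p \<noteq> d" "a \<noteq> d"
        using small_p W(2) w_nth[of d] B by auto
      then have cd: "c + 2 \<le> d" "a < d"
        using B p by auto
      have dec: "u ! Suc i < u ! i" if "c \<le> i" "i < d" for i
        using B(1) that by (auto simp: block_at_def)
      have u_Pop: "u = Pop ((Pop ^^ s) xs)"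
        by (simp add: u_def)
      have single: "block_at ((Pop ^^ s) xs) (Suc c) (Suc c)"
        using block_at_singleton_of_Pop[of c "(Pop ^^ s) xs", folded u_Pop]
          dec[of c] dec[of "Suc c"] cd d u_Pop by simp
      have "d = c + 2"
      proof (rule ccontr)
        assume "d \<noteq> c + 2"
        with cd have "c + 3 \<le> d" by simp
        then show False
          using Pop_decreasing_length_le_3[of c "(Pop ^^ s) xs", folded u_Pop]
            dec[of c] dec[of "Suc c"] dec[of "Suc (Suc c)"] d u_Pop
          by (auto simp: eval_nat_numeral)
      qed
      then have "a = Suc c"
        using cd B p by simp
      then have small_c: "u ! Suc c \<le> v"
        using W(2) w_nth[of a] \<open>d = c + 2\<close> by simp
      have take_c: "take (Suc c) u = take c u @ [u ! c]"
        using d cd by (simp add: take_Suc_conv_app_nth)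
      have prefix': "set (take (Suc c) ((Pop ^^ s) xs)) = set (take (Suc c) u)"
        unfolding u_Pop using set_take_Pop_block[OF single] by simp
      \<comment> \<open>The only additional entry, \<open>u ! c\<close>, is large: it leaves the
        count unchanged, and it is the large entry that the induction hypothesis for
        \<open>s\<close> asks for.\<close>
      have "{x \<in> set (take (Suc c) u). x \<le> v} = {x \<in> set (take c u). x \<le> v}"
        using False by (auto simp: take_c)
      then have "r s (Suc c) = r (Suc s) c"
        by (simp add: r_def prefix' u_def[symmetric] del: funpow.simps)
      moreover have "s < 2 * r s (Suc c)"
        unfolding r_def
      proof (rule less.IH)
        show "(Pop ^^ s) xs ! Suc c \<le> v"
          using small_c nth_Pop_block[OF single, of "Suc c", folded u_Pop] by simp
        show "\<exists>x\<in>set (take (Suc c) ((Pop ^^ s) xs)). v < x"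
          using False by (auto simp: prefix' take_c)
      qed (use s single in auto)
      ultimately show ?thesis
        using r_c by (simp add: s r_def)
    qed
  qed
qed

section \<open>Symmetry under reversal and complement\<close>

text \<open>Values may become 0, which is harmless. Truncated subtraction strictly reverses the
  order only on \<open>{..n}\<close>, hence the bounds on entries in the lemmas below.\<close>

definition reverse_complement :: "nat \<Rightarrow> nat list \<Rightarrow> nat list" where
  "reverse_complement n xs = rev (map (\<lambda>x. n - x) xs)"

lemma length_reverse_complement [simp]: "length (reverse_complement n xs) = length xs"
  by (simp add: reverse_complement_def)

lemma nth_reverse_complement:
  assumes "i < length xs"
  shows "reverse_complement n xs ! i = n - xs ! (length xs - Suc i)"
  using assms by (simp add: reverse_complement_def rev_nth)

text \<open>Reversal and complement each exchange ascents and descents; together they preserve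
  descents and swap the two ends of a block.\<close>

lemma block_at_reverse_complement:
  assumes "block_at xs a b" "set xs \<subseteq> {..n}"
  shows "block_at (reverse_complement n xs) (length xs - Suc b) (length xs - Suc a)"
proof -
  have le: "xs ! i \<le> n" if "i < length xs" for i
    using assms(2) nth_mem[OF that] by auto
  note B = assms(1)[unfolded block_at_def]
  have "reverse_complement n xs ! Suc i < reverse_complement n xs ! i"
    if "length xs - Suc b \<le> i" "i < length xs - Suc a" for i
  proof -
    \<comment> \<open>The mirror images of the positions \<open>i\<close> and \<open>Suc i\<close>
      are \<open>Suc j\<close> and \<open>j\<close>.\<close>
    define j where "j = length xs - Suc (Suc i)"
    have j: "length xs - Suc i = Suc j" "a \<le> j" "j < b"
      using that B by (auto simp: j_def)
    then have "xs ! Suc j < xs ! j" "xs ! j \<le> n"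
      using B le[of j] by auto
    then show ?thesis
      using that j by (simp add: nth_reverse_complement flip: j_def)
  qed
  then show ?thesis
    using B unfolding block_at_def
    by (auto simp: nth_reverse_complement Suc_diff_Suc intro!: diff_le_mono2)
qed

text \<open>Blocks are reflected onto blocks, so both sides can be compared entry by entry through
  \<open>nth_Pop_block\<close>.\<close>

lemma Pop_reverse_complement:
  assumes "set xs \<subseteq> {..n}"
  shows "Pop (reverse_complement n xs) = reverse_complement n (Pop xs)"
proof (rule nth_equalityI)
  fix i assume "i < length (Pop (reverse_complement n xs))"
  then have i: "i < length xs"
    by simp
  then obtain a b where B: "block_at xs a b" "a \<le> length xs - Suc i" "length xs - Suc i \<le> b"
    using block_at_exists[of "length xs - Suc i" xs]
    by (metis diff_Suc_less length_pos_if_in_set nth_mem)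
  have b: "b < length xs"
    using B(1) by (simp add: block_at_def)
  have "Pop (reverse_complement n xs) ! i
      = reverse_complement n xs ! (length xs - Suc b + (length xs - Suc a) - i)"
    by (rule nth_Pop_block[OF block_at_reverse_complement[OF B(1) assms]])
      (use B b i in auto)
  also have "\<dots> = n - xs ! (a + b - (length xs - Suc i))"
  proof -
    have "length xs - Suc (length xs - Suc b + (length xs - Suc a) - i) = a + b - (length xs - Suc i)"
      using B b i by linarith
    then show ?thesis
      using B b i by (subst nth_reverse_complement) auto
  qed
  also have "\<dots> = reverse_complement n (Pop xs) ! i"
    using i nth_Pop_block[OF B] by (simp add: nth_reverse_complement)
  finally show "Pop (reverse_complement n xs) ! i = reverse_complement n (Pop xs) ! i" .
qed simp

lemma Pop_funpow_reverse_complement: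
  assumes "set xs \<subseteq> {..n}"
  shows "(Pop ^^ t) (reverse_complement n xs) = reverse_complement n ((Pop ^^ t) xs)"
proof (induction t)
  case (Suc t)
  have "set ((Pop ^^ t) xs) = set xs"
    by (rule mset_eq_setD) simp
  then show ?case
    using Suc assms by (simp add: Pop_reverse_complement)
qed simp

text \<open>Mirror image of \<open>small_block_start_bound\<close>, obtained with the threshold
  \<open>n - v\<close>.\<close>

lemma large_block_end_bound:
  assumes "distinct xs" "block_at ((Pop ^^ t) xs) a b" "v \<le> (Pop ^^ t) xs ! b"
    and "\<exists>x \<in> set (drop (Suc b) ((Pop ^^ t) xs)). x < v"
  shows "t < 2 * card {x \<in> set (drop (Suc b) ((Pop ^^ t) xs)). v \<le> x}"
proof -
  define w where "w = (Pop ^^ t) xs"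
  have set_w: "set w = set xs"
    unfolding w_def by (rule mset_eq_setD) simp
  define n where "n = Max (set xs)"
  have n: "set xs \<subseteq> {..n}"
    by (auto simp: n_def)
  define rc where "rc = reverse_complement n"
  have rc_w: "(Pop ^^ t) (rc xs) = rc w"
    using Pop_funpow_reverse_complement[OF n] by (simp add: rc_def w_def)
  have b: "b < length w"
    using assms(2) by (simp add: block_at_def w_def)
  define a' where "a' = length w - Suc b"
  have take_rc: "take a' (rc w) = rc (drop (Suc b) w)"
    using b by (simp add: a'_def rc_def reverse_complement_def take_rev drop_map)
  have set_drop: "set (drop (Suc b) w) \<subseteq> {..n}"
    using set_drop_subset[of "Suc b" w] n set_w by auto
  have inj: "inj_on (\<lambda>x. n - x) {..n}"
    by (auto simp: inj_on_def)
  have v: "v \<le> n"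
    using assms(3) b set_w n nth_mem[OF b] by (auto simp: w_def[symmetric])
  have "distinct (rc xs)"
    using assms(1) inj_on_subset[OF inj n]
    by (simp add: rc_def reverse_complement_def distinct_map)
  moreover have "block_at ((Pop ^^ t) (rc xs)) a' (length w - Suc a)"
    unfolding rc_w unfolding a'_def rc_def using assms(2) n set_w
    by (intro block_at_reverse_complement) (auto simp: w_def)
  moreover have "(Pop ^^ t) (rc xs) ! a' \<le> n - v"
    unfolding rc_w using assms(3) b
    by (simp add: rc_def a'_def nth_reverse_complement diff_le_mono2 flip: w_def)
  moreover have "\<exists>x \<in> set (take a' ((Pop ^^ t) (rc xs))). n - v < x"
    unfolding rc_w take_rc using assms(4) v
    by (auto simp: rc_def reverse_complement_def intro!: diff_less_mono2 simp flip: w_def)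
  ultimately have "t < 2 * card {x \<in> set (take a' ((Pop ^^ t) (rc xs))). x \<le> n - v}"
    by (rule small_block_start_bound)
  \<comment> \<open>For \<open>x\<close> and \<open>v\<close> up to \<open>n\<close>,
    \<open>n - x \<le> n - v\<close> is equivalent to \<open>v \<le> x\<close>.\<close>
  also have "{x \<in> set (take a' ((Pop ^^ t) (rc xs))). x \<le> n - v}
      = (\<lambda>x. n - x) ` {x \<in> set (drop (Suc b) w). v \<le> x}"
    unfolding rc_w take_rc using set_drop v by (force simp: rc_def reverse_complement_def)
  also have "card \<dots> = card {x \<in> set (drop (Suc b) w). v \<le> x}"
    by (intro card_image inj_on_subset[OF inj]) (use set_drop in auto)
  finally show ?thesis
    by (simp add: w_def)
qed

section \<open>Interiors of increasing runs and the final bounds\<close>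

lemma in_run_interior_block_at:
  assumes "in_run_interior xs i"
  shows "block_at xs i i"
proof -
  obtain a b where "increasing_between xs a b" "a < i" "i < b"
    using assms by (auto simp: in_run_interior_def increasing_run_def)
  then have "b < length xs" "xs ! (i - 1) < xs ! i" "xs ! i < xs ! Suc i"
    by (auto simp: increasing_between_def)
  then show ?thesis
    using \<open>i < b\<close> by (auto simp: block_at_def)
qed

theorem lemma5:
  fixes n t i :: nat and \<sigma> \<sigma>\<^sub>t :: "nat list"
  assumes "\<sigma> \<in> permutations_of_set {1..n}"
    and "\<sigma>\<^sub>t = (Pop ^^ t) \<sigma>"
    and "in_run_interior \<sigma>\<^sub>t i"
  shows "(left_to_right_max \<sigma>\<^sub>t i \<or>
            \<lceil>(real t + 1) / 2\<rceil> \<le> int (card (smaller_to_left \<sigma>\<^sub>t i))) \<and>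
         (right_to_left_min \<sigma>\<^sub>t i \<or>
            \<lceil>(real t + 1) / 2\<rceil> \<le> int (card (larger_to_right \<sigma>\<^sub>t i)))"
proof -
  have dist: "distinct \<sigma>"
    using assms(1) by (rule permutations_of_setD)
  then have dist_t: "distinct \<sigma>\<^sub>t"
    using mset_eq_imp_distinct_iff[of \<sigma>\<^sub>t \<sigma>] by (simp add: assms(2))
  have block: "block_at \<sigma>\<^sub>t i i"
    using assms(3) by (rule in_run_interior_block_at)
  then have i: "i < length \<sigma>\<^sub>t"
    by (simp add: block_at_def)
  have "distinct (take i \<sigma>\<^sub>t @ \<sigma>\<^sub>t ! i # drop (Suc i) \<sigma>\<^sub>t)"
    using dist_t id_take_nth_drop[OF i] by metis
  then have notin: "\<sigma>\<^sub>t ! i \<notin> set (take i \<sigma>\<^sub>t)" "\<sigma>\<^sub>t ! i \<notin> set (drop (Suc i) \<sigma>\<^sub>t)"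
    by auto
  \<comment> \<open>By integrality \<open>t < 2 * k\<close> means
    \<open>t + 1 \<le> 2 * k\<close>.\<close>
  have ceil: "\<lceil>(real t + 1) / 2\<rceil> \<le> int k" if "t < 2 * k" for k
    using that by (simp add: ceiling_le_iff)
  have "\<lceil>(real t + 1) / 2\<rceil> \<le> int (card (smaller_to_left \<sigma>\<^sub>t i))" if "\<not> left_to_right_max \<sigma>\<^sub>t i"
  proof (rule ceil)
    obtain j where j: "j < i" "\<sigma>\<^sub>t ! i \<le> \<sigma>\<^sub>t ! j"
      using \<open>\<not> left_to_right_max \<sigma>\<^sub>t i\<close> i by (auto simp: left_to_right_max_def not_less)
    then have "\<sigma>\<^sub>t ! j \<in> set (take i \<sigma>\<^sub>t)"
      using i by (auto simp: in_set_conv_nth)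
    with j notin have "\<exists>x \<in> set (take i \<sigma>\<^sub>t). \<sigma>\<^sub>t ! i < x"
      by (metis le_neq_implies_less)
    \<comment> \<open>The block is the singleton at \<open>i\<close>, and the threshold is its own
      entry.\<close>
    then have "t < 2 * card {x \<in> set (take i \<sigma>\<^sub>t). x \<le> \<sigma>\<^sub>t ! i}"
      using small_block_start_bound[OF dist, of t i i "\<sigma>\<^sub>t ! i"] block by (simp add: assms(2))
    \<comment> \<open>Distinctness rules out equality, so the weak and strict counts agree.\<close>
    also have "{x \<in> set (take i \<sigma>\<^sub>t). x \<le> \<sigma>\<^sub>t ! i} = smaller_to_left \<sigma>\<^sub>t i"
      using notin by (auto simp: smaller_to_left_def order_le_less)
    finally show "t < 2 * card (smaller_to_left \<sigma>\<^sub>t i)" .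
  qed
  moreover have "\<lceil>(real t + 1) / 2\<rceil> \<le> int (card (larger_to_right \<sigma>\<^sub>t i))"
    if "\<not> right_to_left_min \<sigma>\<^sub>t i"
  proof (rule ceil)
    obtain j where j: "i < j" "j < length \<sigma>\<^sub>t" "\<sigma>\<^sub>t ! j \<le> \<sigma>\<^sub>t ! i"
      using \<open>\<not> right_to_left_min \<sigma>\<^sub>t i\<close> i by (auto simp: right_to_left_min_def not_less)
    then have "\<sigma>\<^sub>t ! j \<in> set (drop (Suc i) \<sigma>\<^sub>t)"
      by (auto simp: in_set_conv_nth intro!: exI[of _ "j - Suc i"])
    with j notin have "\<exists>x \<in> set (drop (Suc i) \<sigma>\<^sub>t). x < \<sigma>\<^sub>t ! i"
      by (metis le_neq_implies_less)
    then have "t < 2 * card {x \<in> set (drop (Suc i) \<sigma>\<^sub>t). \<sigma>\<^sub>t ! i \<le> x}"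
      using large_block_end_bound[OF dist, of t i i "\<sigma>\<^sub>t ! i"] block by (simp add: assms(2))
    also have "{x \<in> set (drop (Suc i) \<sigma>\<^sub>t). \<sigma>\<^sub>t ! i \<le> x} = larger_to_right \<sigma>\<^sub>t i"
      using notin by (auto simp: larger_to_right_def order_le_less)
    finally show "t < 2 * card (larger_to_right \<sigma>\<^sub>t i)" .
  qed
  ultimately show ?thesis
    by blast
qed

end
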